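(* Let $0<q<1$, let $z\in\mathbb{C}$ with $\Re z>0$, and put $\delta=\frac{2\pi i}{\log q}$. Then $$\zeta(s,z:q)=-\frac{(q-q^2)^s}{s\log q}F(s,s,s+1:q^z)+\frac12\Big(\frac{q-q^2}{1-q^z}\Big)^s+\frac{s(q-q^2)^s}{2\pi i}\sum_{l\ne0}\frac{1}{l(s+\delta l)}F(s+1,s+\delta l,s+1+\delta l:q^z),$$ where $l$ runs over the nonzero integers. The infinite series on the right-hand side converges absolutely for $s\ne -r+\delta l$ ($r\in\mathbb{Z}_{\ge0}$, $l\in\mathbb{Z}$, $l\neq 0$), and hence is holomorphic in this region.
   Context: $[x]_q=\frac{1-q^x}{1-q}$, and $\zeta(s,z:q)$ denotes the meromorphic continuation to the whole $s$-plane of $\sum_{k=0}^{\infty}q^{s(k+1)}/[k+z]_q^{\,s}$ (convergent for $\Re s>0$), with complex powers taken using the principal branch. $F(\alpha,\beta,\gamma:x)$ is the Gauss hypergeometric function ${}_2F_1(\alpha,\beta;\gamma;x)$. *)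

theory Defs
  imports "HOL-Complex_Analysis.Complex_Analysis"
begin

definition qnum :: "real \<Rightarrow> complex \<Rightarrow> complex" where
  "qnum q x = (1 - complex_of_real q powr x) / (1 - complex_of_real q)"

definition qzeta_series :: "real \<Rightarrow> complex \<Rightarrow> complex \<Rightarrow> complex" where
  "qzeta_series q z s =
     (\<Sum>k. complex_of_real q powr (s * of_nat (k + 1)) / (qnum q (of_nat k + z)) powr s)"

text \<open>zeta(s,z:q): the meromorphic continuation of the series to the whole plane,
  normalised (nicely meromorphic: value = limit at removable points, 0 at poles),
  which makes it unique.\<close>
definition qzeta :: "real \<Rightarrow> complex \<Rightarrow> complex \<Rightarrow> complex" where
  "qzeta q z = (THE f. f nicely_meromorphic_on UNIV \<and>
                       (\<forall>s. 0 < Re s \<longrightarrow> f s = qzeta_series q z s))"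

definition hyp2F1 :: "complex \<Rightarrow> complex \<Rightarrow> complex \<Rightarrow> complex \<Rightarrow> complex" where
  "hyp2F1 a b c x =
     (\<Sum>n. pochhammer a n * pochhammer b n / (pochhammer c n * fact n) * x ^ n)"

end

theory Submission
  imports Defs
begin

text \<open>
  With $x = q^z$ and $c = q - q^2$, expanding $(1 - q^k x)^{-s}$ by the binomial theorem and summing
  the geometric series in $k$ gives
  $\zeta(s,z:q) = c^s \sum_n \frac{(s)_n}{n!} \frac{x^n}{1 - q^{s+n}}$ for $\Re s > 0$. The right-hand
  side is meromorphic on the whole plane, so by uniqueness of meromorphic continuation the formula
  holds everywhere. Inserting the partial fraction expansion
  $\frac{1}{1 - q^w} =
  \frac12 - \frac{1}{w \log q} + \frac{w}{2 \pi i} \sum_{l \ne 0} \frac{1}{l (w + \delta l)}$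
  at $w = s + n$ and exchanging the order of summation yields the three terms of the theorem, because
  $(s)_n (s + n) = s (s + 1)_n$ and $\frac{(a)_n}{(a+1)_n} = \frac{a}{a + n}$. The double series converges
  absolutely, and locally uniformly in $s$, because $|s + n + \delta l|$ is at least a constant times $|l|$.
\<close>

subsection \<open>Infinite sums and meromorphic functions\<close>

text \<open>By the Weierstrass M-test the finite partial sums converge uniformly on a closed ball
  around each point, and holomorphy passes to the limit on the open ball. The majorant may change
  with the point, so no bound near the boundary of \<open>A\<close> is asked for.\<close>

lemma holomorphic_on_infsum:
  fixes f :: "'a \<Rightarrow> complex \<Rightarrow> complex"
  assumes "open A"
    and hol: "\<And>i. i \<in> I \<Longrightarrow> f i holomorphic_on A"
    and bound: "\<And>s. s \<in> A \<Longrightarrow> \<exists>r>0. \<exists>M. M summable_on I \<and>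
                  (\<forall>i\<in>I. \<forall>w\<in>cball s r. norm (f i w) \<le> M i)"
  shows "(\<lambda>s. \<Sum>\<^sub>\<infinity>i\<in>I. f i s) holomorphic_on A"
proof -
  have "\<exists>e>0. (\<lambda>s. \<Sum>\<^sub>\<infinity>i\<in>I. f i s) holomorphic_on ball s e" if s: "s \<in> A" for s
  proof -
    obtain r M where r: "r > 0" "M summable_on I" "\<forall>i\<in>I. \<forall>w\<in>cball s r. norm (f i w) \<le> M i"
      using bound[OF s] by blast
    obtain r' where r': "r' > 0" "cball s r' \<subseteq> A"
      using \<open>open A\<close> s open_contains_cball by blast
    define e where "e = min r r'"
    have e: "e > 0" "cball s e \<subseteq> A" "cball s e \<subseteq> cball s r"
      using r r' by (auto simp: e_def)
    have u: "uniform_limit (cball s e) (\<lambda>X w. \<Sum>i\<in>X. f i w) (\<lambda>w. \<Sum>\<^sub>\<infinity>i\<in>I. f i w)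
               (finite_subsets_at_top I)"
      using r e by (intro Weierstrass_m_test_general[where M = M]) auto
    have "\<forall>\<^sub>F X in finite_subsets_at_top I.
        continuous_on (cball s e) (\<lambda>w. \<Sum>i\<in>X. f i w) \<and> (\<lambda>w. \<Sum>i\<in>X. f i w) holomorphic_on ball s e"
    proof (rule eventually_finite_subsets_at_top_weakI)
      fix X assume X: "finite X" "X \<subseteq> I"
      have "(\<lambda>w. \<Sum>i\<in>X. f i w) holomorphic_on A"
        using X hol by (intro holomorphic_on_sum) auto
      then have "(\<lambda>w. \<Sum>i\<in>X. f i w) holomorphic_on cball s e"
        using e(2) holomorphic_on_subset by blast
      then show "continuous_on (cball s e) (\<lambda>w. \<Sum>i\<in>X. f i w) \<and>
                 (\<lambda>w. \<Sum>i\<in>X. f i w) holomorphic_on ball s e"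
        using holomorphic_on_imp_continuous_on holomorphic_on_subset[OF _ ball_subset_cball] by auto
    qed
    from holomorphic_uniform_limit[OF this u] have "(\<lambda>s. \<Sum>\<^sub>\<infinity>i\<in>I. f i s) holomorphic_on ball s e"
      by simp
    then show ?thesis using e by blast
  qed
  then have "(\<lambda>s. \<Sum>\<^sub>\<infinity>i\<in>I. f i s) analytic_on A"
    by (auto simp: analytic_on_def)
  then show ?thesis
    by (rule analytic_imp_holomorphic)
qed

lemma summable_on_product_nonneg:
  fixes f :: "'a \<Rightarrow> real" and g :: "'b \<Rightarrow> real"
  assumes "f summable_on A" "g summable_on B"
    and "\<And>a. a \<in> A \<Longrightarrow> f a \<ge> 0" "\<And>b. b \<in> B \<Longrightarrow> g b \<ge> 0"
  shows "(\<lambda>(a, b). f a * g b) summable_on A \<times> B"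
proof (rule summable_on_SigmaI)
  show "((\<lambda>b. case (a, b) of (a, b) \<Rightarrow> f a * g b) has_sum f a * infsum g B) B" for a
    using has_sum_cmult_right[OF has_sum_infsum[OF assms(2)]] by simp
  show "(\<lambda>a. f a * infsum g B) summable_on A"
    by (intro summable_on_cmult_left assms)
qed (use assms in auto)

lemma suminf_eq_infsum:
  fixes f :: "nat \<Rightarrow> 'a :: {t2_space, topological_comm_monoid_add}"
  assumes "f summable_on UNIV"
  shows "suminf f = infsum f UNIV"
  using has_sum_imp_sums[OF has_sum_infsum[OF assms]] by (rule sums_unique[symmetric])

text \<open>Identity theorem: the difference vanishes off a sparse set or is nonzero off a sparse
  set, and agreement near \<open>z0\<close> excludes the second case. The exceptional points are
  recovered because a nicely meromorphic function equals its own
  \<open>remove_sings\<close>.\<close>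

lemma nicely_meromorphic_on_eqI:
  assumes f: "f nicely_meromorphic_on A" and g: "g nicely_meromorphic_on A"
    and A: "open A" "connected A" and z0: "z0 \<in> A" "\<forall>\<^sub>F z in at z0. f z = g z" and z: "z \<in> A"
  shows "f z = g z"
proof -
  have mero: "f meromorphic_on A" "g meromorphic_on A"
    using f g by (auto simp: nicely_meromorphic_on_def)
  then have "(\<lambda>z. f z - g z) meromorphic_on A"
    by (intro meromorphic_intros)
  from meromorphic_imp_constant_or_avoid[OF this A, of 0]
  consider "\<forall>\<^sub>\<approx>z\<in>A. f z - g z = 0" | "\<forall>\<^sub>\<approx>z\<in>A. f z - g z \<noteq> 0"
    by blast
  then have "\<forall>\<^sub>\<approx>z\<in>A. f z - g z = 0"
  proof cases
    case 2
    then have "\<forall>\<^sub>F z in at z0. f z - g z \<noteq> 0"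
      using A z0 by (simp add: eventually_cosparse_open_eq)
    with z0(2) have "\<forall>\<^sub>F z in at z0. False"
      by eventually_elim auto
    then show ?thesis by simp
  qed
  then have "\<forall>\<^sub>F w in at z. f w = g w"
    using A z by (simp add: eventually_cosparse_open_eq)
  then have "remove_sings f z = remove_sings g z"
    by (intro remove_sings_cong) auto
  moreover have "remove_sings h z = h z" if "h nicely_meromorphic_on A" for h
    using that z by (auto simp: nicely_meromorphic_on_def)
  ultimately show ?thesis
    using f g by simp
qed

text \<open>Points of \<open>A\<close> near the origin stay at distance at least \<open>r\<close>
  from the ball, while far ones dominate it in norm. Applied to sets of poles, this makes
  denominators grow linearly, uniformly for \<open>w\<close> near \<open>s\<close>.\<close>

lemma norm_diff_ge_closed:
  fixes A :: "'a :: real_normed_vector set"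
  assumes "closed A" "s \<notin> A"
  obtains r k where "r > 0" "k > 0"
    "\<And>w a. w \<in> cball s r \<Longrightarrow> a \<in> A \<Longrightarrow> k * norm a \<le> norm (w - a)"
proof -
  obtain e where e: "e > 0" "ball s e \<subseteq> - A"
    using assms open_contains_ball[of "- A"] by auto
  define r where "r = e / 2"
  define M where "M = norm s + r"
  \<comment> \<open>The first entry serves \<open>norm a \<le> 2 * M\<close>, where the distance is
    at least \<open>r\<close>; the second serves larger \<open>a\<close>, where it is at least
    \<open>norm a - M\<close>, hence more than half of \<open>norm a\<close>.\<close>
  define k where "k = min (r / (2 * M)) (1 / 2)"
  have r: "r > 0" "M > 0"
    using e by (auto simp: r_def M_def intro: add_nonneg_pos)
  show ?thesis
  proof
    show "r > 0" "k > 0"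
      using r by (auto simp: k_def)
    fix w a assume w: "w \<in> cball s r" and a: "a \<in> A"
    have "a \<notin> ball s e" using a e by auto
    then have "e \<le> norm (s - a)" by (simp add: dist_norm)
    moreover have ws: "norm (s - w) \<le> r" using w by (simp add: dist_norm)
    moreover have "norm (s - a) \<le> norm (s - w) + norm (w - a)"
      using norm_triangle_ineq[of "s - w" "w - a"] by simp
    ultimately have 1: "r \<le> norm (w - a)"
      by (simp add: r_def)
    have "norm w \<le> M"
      using norm_triangle_ineq[of s "w - s"] ws by (simp add: M_def norm_minus_commute)
    then have 2: "norm a - M \<le> norm (w - a)"
      using norm_triangle_ineq2[of a w] by (simp add: norm_minus_commute)
    show "k * norm a \<le> norm (w - a)"
    proof (cases "norm a \<le> 2 * M")
      case True
      have "k * norm a \<le> r / (2 * M) * (2 * M)"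
        using True r by (intro mult_mono) (auto simp: k_def)
      also have "\<dots> = r" using r by simp
      finally show ?thesis using 1 by simp
    next
      case False
      have "k * norm a \<le> 1 / 2 * norm a"
        by (intro mult_right_mono) (auto simp: k_def)
      then show ?thesis using False 2 by simp
    qed
  qed
qed

text \<open>The points are uniformly separated: the imaginary part of a difference detects a change
  of \<open>l\<close>, and for equal \<open>l\<close> the real part detects a change of
  \<open>m\<close>. Uniform separation is inherited by every subset.\<close>

lemma closed_lattice_subset:
  fixes d :: complex
  assumes d: "Im d \<noteq> 0" and S: "S \<subseteq> {of_int m + d * of_int l | m l. True}"
  shows "closed S"
proof (rule discrete_imp_closed)
  show "0 < min 1 \<bar>Im d\<bar>" using d by simp
  show "\<forall>x\<in>S. \<forall>y\<in>S. dist y x < min 1 \<bar>Im d\<bar> \<longrightarrow> y = x"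
  proof safe
    fix x y assume "x \<in> S" "y \<in> S" and dist: "dist y x < min 1 \<bar>Im d\<bar>"
    then obtain m l m' l' where x: "x = of_int m + d * of_int l" and y: "y = of_int m' + d * of_int l'"
      using S by blast
    have "\<bar>Im (y - x)\<bar> < \<bar>Im d\<bar>"
      using dist abs_Im_le_cmod[of "y - x"] by (simp add: dist_norm)
    also have "Im (y - x) = Im d * of_int (l' - l)"
      by (simp add: x y algebra_simps)
    finally have "\<bar>real_of_int (l' - l)\<bar> < 1"
      using d by (simp add: abs_mult)
    then have l: "l' = l" by linarith
    have "\<bar>Re (y - x)\<bar> < 1"
      using dist abs_Re_le_cmod[of "y - x"] by (simp add: dist_norm)
    also have "Re (y - x) = of_int (m' - m)"
      by (simp add: x y l)
    finally have "m' = m" by linarith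
    with l show "y = x" by (simp add: x y)
  qed
qed

subsection \<open>Partial fractions of the cotangent\<close>

lemma nonzero_ints_decompose:
  "{l::int. l \<noteq> 0} = range (\<lambda>n. int (Suc n)) \<union> range (\<lambda>n. - int (Suc n))"
proof -
  have "l \<in> range (\<lambda>n. int (Suc n)) \<union> range (\<lambda>n. - int (Suc n))" if "l \<noteq> 0" for l
  proof (cases "l > 0")
    case True
    then have "l = int (Suc (nat (l - 1)))" by auto
    then show ?thesis by blast
  next
    case False
    then have "l = - int (Suc (nat (- l - 1)))" using that by auto
    then show ?thesis by blast
  qed
  then show ?thesis by auto
qed

lemma summable_on_inverse_squares_int: "(\<lambda>l::int. 1 / (of_int l)\<^sup>2 :: real) summable_on {l. l \<noteq> 0}"
proof -
  have "summable (\<lambda>n. 1 / (real (Suc n))\<^sup>2)"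
    using inverse_power_summable[of 2, where 'a = real]
    by (subst summable_Suc_iff) (simp add: field_simps)
  then have *: "(\<lambda>n. 1 / (real (Suc n))\<^sup>2) summable_on UNIV"
    by (intro norm_summable_imp_summable_on) simp
  have "(\<lambda>l::int. 1 / (of_int l)\<^sup>2 :: real) summable_on range (\<lambda>n. int (Suc n))"
    using * by (subst summable_on_reindex) (auto simp: inj_on_def o_def)
  moreover have "(\<lambda>l::int. 1 / (of_int l)\<^sup>2 :: real) summable_on range (\<lambda>n. - int (Suc n))"
    using * by (subst summable_on_reindex)
      (simp_all add: inj_on_def o_def power2_commute[of "- 1" "real _", simplified] add.commute)
  ultimately show ?thesis
    unfolding nonzero_ints_decompose by (rule summable_on_Un_disjoint) auto
qed

text \<open>Pairing \<open>l\<close> with \<open>- l\<close> turns the unordered sum into an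
  ordinary series, the form in which the Digamma series can be compared with it.\<close>

lemma sums_nonzero_ints:
  fixes f :: "int \<Rightarrow> 'a :: banach"
  assumes "f summable_on {l. l \<noteq> 0}"
  shows "(\<lambda>n. f (int (Suc n)) + f (- int (Suc n))) sums infsum f {l. l \<noteq> 0}"
proof -
  have 1: "f summable_on range (\<lambda>n. int (Suc n))" and 2: "f summable_on range (\<lambda>n. - int (Suc n))"
    by (rule summable_on_subset_banach[OF assms]; auto)+
  have *: "(\<lambda>n. f (g n)) sums infsum f (range g)" if "f summable_on range g" "inj g" for g :: "nat \<Rightarrow> int"
    using has_sum_reindex[OF that(2), of f] has_sum_infsum[OF that(1)]
    by (intro has_sum_imp_sums) (simp add: o_def)
  have "(\<lambda>n. f (int (Suc n))) sums infsum f (range (\<lambda>n. int (Suc n)))"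
    by (rule *[OF 1]) (auto simp: inj_on_def)
  moreover have "(\<lambda>n. f (- int (Suc n))) sums infsum f (range (\<lambda>n. - int (Suc n)))"
    by (rule *[OF 2]) (auto simp: inj_on_def)
  moreover have "infsum f {l. l \<noteq> 0} =
      infsum f (range (\<lambda>n. int (Suc n))) + infsum f (range (\<lambda>n. - int (Suc n)))"
    unfolding nonzero_ints_decompose by (rule infsum_Un_disjoint[OF 1 2]) auto
  ultimately show ?thesis
    by (simp only: sums_add)
qed

text \<open>This is the logarithmic derivative of the reflection formula for \<open>rGamma\<close>:
  differentiate both sides and divide by the product, which is nonzero off the integers.\<close>

lemma Digamma_reflection_complex:
  fixes u :: complex
  assumes "u \<notin> \<int>"
  shows "Digamma (1 - u) - Digamma u = of_real pi * cot (of_real pi * u)"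
proof -
  have u: "u \<notin> \<int>\<^sub>\<le>\<^sub>0" "1 - u \<notin> \<int>\<^sub>\<le>\<^sub>0"
    using assms nonpos_Ints_Int Ints_diff[of 1 "1 - u"] by fastforce+
  have nz: "rGamma u \<noteq> 0" "rGamma (1 - u) \<noteq> 0"
    using u by (auto simp: rGamma_eq_zero_iff)
  have "((\<lambda>u. rGamma u * rGamma (1 - u)) has_field_derivative
          rGamma u * rGamma (1 - u) * (Digamma (1 - u) - Digamma u)) (at u)"
    using u by (auto intro!: derivative_eq_intros simp: algebra_simps)
  moreover have "((\<lambda>u. sin (of_real pi * u) / of_real pi) has_field_derivative cos (of_real pi * u)) (at u)"
    by (auto intro!: derivative_eq_intros)
  ultimately have "rGamma u * rGamma (1 - u) * (Digamma (1 - u) - Digamma u) = cos (of_real pi * u)"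
    unfolding rGamma_reflection_complex[symmetric] by (rule DERIV_unique)
  moreover have "rGamma u * rGamma (1 - u) = sin (of_real pi * u) / of_real pi"
    by (rule rGamma_reflection_complex)
  moreover from this nz have "sin (of_real pi * u) \<noteq> 0" by auto
  ultimately show ?thesis
    by (simp add: cot_def field_simps)
qed

text \<open>The paired terms for \<open>l\<close> and \<open>- l\<close> are, up to the factor
  \<open>- u\<close>, differences of terms of the Digamma series at \<open>1 - u\<close> and
  \<open>u + 1\<close>; reflection turns the resulting difference of Digamma values into a
  cotangent.\<close>

lemma cot_partial_fractions:
  fixes u :: complex
  assumes "u \<notin> \<int>"
  shows "((\<lambda>l::int. 1 / (of_int l * (u + of_int l))) has_sum
          (1 / u - of_real pi * cot (of_real pi * u)) / u) {l. l \<noteq> 0}"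
proof -
  have u0: "u \<noteq> 0" using assms by auto
  have nz: "u + of_int l \<noteq> 0" for l
    using assms Ints_of_int[of "- l"] by (auto simp: add_eq_0_iff2)
  define f :: "int \<Rightarrow> complex" where "f = (\<lambda>l. 1 / (of_int l * (u + of_int l)))"
  \<comment> \<open>Distance from the closed set of integers gives a lower bound
    \<open>k * \<bar>l\<bar>\<close> for the norm of \<open>u + l\<close>, so the terms are of order
    1/l^2.\<close>
  have "closed (\<int> :: complex set)" by simp
  then obtain r k where k: "r > 0" "k > 0"
    "\<And>w a. w \<in> cball u r \<Longrightarrow> a \<in> \<int> \<Longrightarrow> k * norm a \<le> norm (w - a)"
    using norm_diff_ge_closed[OF _ assms] by blast
  have "norm (f l) \<le> 1 / k * (1 / (of_int l)\<^sup>2)" if "l \<noteq> 0" for l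
  proof -
    have "k * \<bar>of_int l\<bar> \<le> norm (u + of_int l)"
      using k(3)[of u "- of_int l"] k(1) by simp
    then have "1 / norm (u + of_int l) \<le> 1 / (k * \<bar>of_int l\<bar>)"
      using k that by (intro divide_left_mono) (auto intro: mult_pos_pos simp: nz)
    then have "1 / \<bar>of_int l\<bar> * (1 / norm (u + of_int l)) \<le> 1 / \<bar>of_int l\<bar> * (1 / (k * \<bar>of_int l\<bar>))"
      by (rule mult_left_mono) simp
    then show ?thesis
      by (simp add: f_def norm_divide norm_mult power2_eq_square mult_ac)
  qed
  then have "(\<lambda>l. norm (f l)) summable_on {l. l \<noteq> 0}"
    by (intro Infinite_Sum.abs_summable_on_comparison_test'[OF summable_on_cmult_right[OF summable_on_inverse_squares_int, of "1 / k"]]) auto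
  then have sf: "f summable_on {l. l \<noteq> 0}"
    by (rule abs_summable_summable)
  \<comment> \<open>The harmonic terms cancel, but they make each half a convergent Digamma series.
    The arguments are \<open>1 - u\<close> and \<open>u + 1\<close> because the pairs start at l = 1
    and l = -1.\<close>
  have "(\<lambda>n. (inverse (of_nat (Suc n)) - inverse (1 - u + of_nat n)) - (inverse (of_nat (Suc n)) - inverse (u + 1 + of_nat n)))
          sums ((Digamma (1 - u) + euler_mascheroni) - (Digamma (u + 1) + euler_mascheroni))"
  proof (rule sums_diff)
    have "1 - u \<noteq> 0" "u + 1 \<noteq> 0"
      using assms nz[of 1] by auto
    moreover have "(\<lambda>n. inverse (of_nat (Suc n)) - inverse (v + of_nat n)) sums (Digamma v + euler_mascheroni)"
      if "v \<noteq> 0" for v :: complex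
      using summable_sums[OF summable_Digamma[OF that]] by (simp add: Digamma_def del: of_nat_Suc)
    ultimately show "(\<lambda>n. inverse (of_nat (Suc n)) - inverse (1 - u + of_nat n)) sums (Digamma (1 - u) + euler_mascheroni)"
      "(\<lambda>n. inverse (of_nat (Suc n)) - inverse (u + 1 + of_nat n)) sums (Digamma (u + 1) + euler_mascheroni)"
      by blast+
  qed
  also have "(\<lambda>n. (inverse (of_nat (Suc n)) - inverse (1 - u + of_nat n)) - (inverse (of_nat (Suc n)) - inverse (u + 1 + of_nat n)))
     = (\<lambda>n. - u * (f (int (Suc n)) + f (- int (Suc n))))"
  proof
    fix n :: nat
    define m :: complex where "m = of_nat (Suc n)"
    have "m \<noteq> 0" "u + m \<noteq> 0" "m - u \<noteq> 0" "u - m \<noteq> 0"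
      using nz[of "int (Suc n)"] nz[of "- int (Suc n)"] by (auto simp: m_def simp del: of_nat_Suc)
    then have "inverse (u + m) - inverse (m - u) = - u * (1 / (m * (u + m)) + 1 / (- m * (u - m)))"
      by (simp add: divide_simps) (simp add: algebra_simps)
    then show "(inverse (of_nat (Suc n)) - inverse (1 - u + of_nat n)) - (inverse (of_nat (Suc n)) - inverse (u + 1 + of_nat n))
      = - u * (f (int (Suc n)) + f (- int (Suc n)))"
      by (simp add: f_def m_def algebra_simps)
  qed
  finally have "(\<lambda>n. - u * (f (int (Suc n)) + f (- int (Suc n)))) sums (Digamma (1 - u) - Digamma (u + 1))"
    by simp
  moreover have "(\<lambda>n. - u * (f (int (Suc n)) + f (- int (Suc n)))) sums (- u * infsum f {l. l \<noteq> 0})"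
    by (intro sums_mult sums_nonzero_ints sf)
  ultimately have "- u * infsum f {l. l \<noteq> 0} = Digamma (1 - u) - Digamma (u + 1)"
    by (rule sums_unique2[symmetric])
  \<comment> \<open>The recurrence of Digamma moves \<open>u + 1\<close> back to \<open>u\<close>,
    as reflection requires, and this produces the term \<open>1 / u\<close>.\<close>
  also have "\<dots> = of_real pi * cot (of_real pi * u) - 1 / u"
    using Digamma_plus1[OF u0] Digamma_reflection_complex[OF assms] by simp
  finally have "infsum f {l. l \<noteq> 0} = (1 / u - of_real pi * cot (of_real pi * u)) / u"
    using u0 by (simp add: field_simps)
  with has_sum_infsum[OF sf] show ?thesis
    by (simp add: f_def)
qed

subsection \<open>Binomial and hypergeometric series\<close>

text \<open>The generalised binomial series with exponent \<open>- s\<close> at \<open>- y\<close>;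
  the sign (-1)^n in the binomial coefficient cancels against that of the power.\<close>

lemma pochhammer_binomial_sums:
  fixes y s :: complex
  assumes "norm y < 1"
  shows "(\<lambda>n. pochhammer s n / fact n * y ^ n) sums (1 - y) powr (- s)"
proof -
  have "((- s) gchoose n) * (- y) ^ n = pochhammer s n / fact n * y ^ n" for n
  proof -
    have "(- 1) ^ n * (- y) ^ n = y ^ n"
      by (simp flip: power_mult_distrib)
    then show ?thesis
      by (simp add: gbinomial_pochhammer mult_ac)
  qed
  then show ?thesis
    using gen_binomial_complex[of "- y" "- s"] assms by simp
qed

text \<open>The complex binomial series at real arguments converges, and nonnegative terms upgrade
  this to unordered summability. It supplies the majorants in \<open>n\<close>.\<close>

lemma summable_on_pochhammer_binomial:
  fixes r R :: real
  assumes "0 \<le> r" "r < 1" "0 \<le> R"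
  shows "(\<lambda>n. pochhammer R n / fact n * r ^ n) summable_on UNIV"
proof -
  have "summable (\<lambda>n. complex_of_real (pochhammer R n / fact n * r ^ n))"
    using pochhammer_binomial_sums[of "of_real r" "of_real R"] assms
    by (simp add: sums_iff pochhammer_of_real)
  then have "summable (\<lambda>n. pochhammer R n / fact n * r ^ n)"
    by (simp only: summable_complex_of_real)
  moreover have "pochhammer R n \<ge> 0" for n
    using assms by (induction n) (auto simp: pochhammer_Suc)
  ultimately show ?thesis
    using assms by (subst summable_on_UNIV_nonneg_real_iff) auto
qed

lemma norm_pochhammer_le:
  fixes s :: complex
  assumes "norm s \<le> R"
  shows "norm (pochhammer s n) \<le> pochhammer R n"
proof (induction n)
  case (Suc n)
  have "norm (s + of_nat n) \<le> R + real n"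
    using assms norm_triangle_ineq[of s "of_nat n"] by simp
  with Suc show ?case
    by (auto simp: pochhammer_Suc norm_mult intro: mult_mono order_trans[OF norm_ge_zero])
qed auto

text \<open>For lower parameter \<open>a + 1\<close> the quotient of the Pochhammer symbols of
  \<open>a\<close> and \<open>a + 1\<close> telescopes to \<open>a / (a + n)\<close>.\<close>

lemma hyp2F1_succ:
  assumes "\<And>n. a + of_nat n \<noteq> 0"
  shows "hyp2F1 b a (a + 1) x = (\<Sum>n. pochhammer b n / fact n * x ^ n * (a / (a + of_nat n)))"
proof -
  have a0: "a \<noteq> 0" using assms[of 0] by simp
  have "pochhammer a n / pochhammer (a + 1) n = a / (a + of_nat n)" for n
  proof -
    have "a * pochhammer (a + 1) n = pochhammer a n * (a + of_nat n)"
      using pochhammer_rec[of a n] pochhammer_Suc[of a n] by simp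
    moreover have "pochhammer a m \<noteq> 0" for m
      using assms by (auto simp: pochhammer_eq_0_iff add_eq_0_iff2)
    then have "pochhammer (a + 1) n \<noteq> 0"
      using pochhammer_rec[of a n] by auto
    ultimately show ?thesis
      using assms[of n] by (simp add: divide_eq_eq eq_divide_eq mult.commute)
  qed
  note ratio = this
  have "pochhammer b n * pochhammer a n / (pochhammer (a + 1) n * fact n) * x ^ n =
             pochhammer b n / fact n * x ^ n * (a / (a + of_nat n))" for n
    unfolding ratio[symmetric] by (simp add: mult_ac)
  then show ?thesis
    by (simp add: hyp2F1_def)
qed

subsection \<open>The $q$-zeta function\<close>

locale q_zeta =
  fixes q :: real and z :: complex
  assumes q: "0 < q" "q < 1" and z: "0 < Re z"
begin

definition x :: complex where "x = complex_of_real q powr z"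

definition c :: complex where "c = complex_of_real (q - q\<^sup>2)"

definition \<delta> :: complex where "\<delta> = 2 * complex_of_real pi * \<i> / complex_of_real (ln q)"

text \<open>General term of the binomial expansion of (1 - x)^(-s).\<close>

definition binom :: "complex \<Rightarrow> nat \<Rightarrow> complex" where
  "binom s n = pochhammer s n / fact n * x ^ n"

text \<open>Majorant of \<open>binom s\<close> for \<open>norm s \<le> R\<close>: the term of the
  real expansion of (1 - |x|)^(-R).\<close>

definition binom_bound :: "real \<Rightarrow> nat \<Rightarrow> real" where
  "binom_bound R n = pochhammer R n / fact n * norm x ^ n"

text \<open>The continuation without its factor \<open>c powr s\<close>. At a point of
  \<open>poles\<close> a vanishing denominator makes its term 0 by the convention for division, so
  the value there is not meaningful.\<close>

definition Z :: "complex \<Rightarrow> complex" where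
  "Z s = (\<Sum>\<^sub>\<infinity>n. binom s n / (1 - complex_of_real q powr (s + of_nat n)))"

text \<open>The zeros of the denominators in \<open>Z\<close>; \<open>\<delta>\<close> is a
  generating period of w -> q^w.\<close>

definition poles :: "complex set" where
  "poles = {- of_nat n + \<delta> * of_int l | n l. True}"

section \<open>Elementary facts about q^w, the pole lattice and the binomial majorants\<close>

lemma norm_q_powr: "norm (complex_of_real q powr w) = q powr Re w"
  using q by (simp add: norm_powr_real_powr)

lemma norm_x: "norm x < 1"
  unfolding x_def norm_q_powr using q z by (simp add: powr01_less_one)

lemma ln_q: "ln q < 0"
  using q by simp

lemma Im_delta: "Im \<delta> \<noteq> 0"
  using ln_q by (simp add: \<delta>_def Im_divide_of_real)

lemma delta_nz: "\<delta> \<noteq> 0"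
  using Im_delta by auto

text \<open>Stated for subsets so that it serves both \<open>poles\<close> and
  \<open>series_poles\<close>.\<close>

lemma closed_poles_subset:
  assumes "S \<subseteq> poles"
  shows "closed S"
proof (rule closed_lattice_subset[OF Im_delta])
  have "- of_nat n + \<delta> * of_int l = of_int (- int n) + \<delta> * of_int l" for n l by simp
  then show "S \<subseteq> {of_int m + \<delta> * of_int l |m l. True}"
    using assms unfolding poles_def by blast
qed

lemma norm_binom_le: "norm s \<le> R \<Longrightarrow> norm (binom s n) \<le> binom_bound R n"
  unfolding binom_def binom_bound_def
  by (auto simp: norm_mult norm_divide norm_power intro!: mult_right_mono divide_right_mono norm_pochhammer_le)

lemma summable_binom_bound: "0 \<le> R \<Longrightarrow> binom_bound R summable_on UNIV"
  unfolding binom_bound_def using norm_x by (intro summable_on_pochhammer_binomial) auto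

lemma binom_bound_nonneg: "0 \<le> R \<Longrightarrow> 0 \<le> binom_bound R n"
  using norm_binom_le[of 0 R n] by (auto intro: order_trans[OF norm_ge_zero])

lemma summable_binom_mult:
  assumes "\<And>n. norm (g n) \<le> K"
  shows "(\<lambda>n. binom s n * g n) summable_on UNIV"
proof (rule abs_summable_summable, rule Infinite_Sum.abs_summable_on_comparison_test')
  show "(\<lambda>n. binom_bound (norm s) n * K) summable_on UNIV"
    by (intro summable_on_cmult_left summable_binom_bound) simp
  show "norm (binom s n * g n) \<le> binom_bound (norm s) n * K" for n
    unfolding norm_mult by (intro mult_mono norm_binom_le assms binom_bound_nonneg) auto
qed

lemma binom_sum: "(\<Sum>\<^sub>\<infinity>n. binom s n) = (1 - x) powr (- s)"
  using pochhammer_binomial_sums[OF norm_x, of s] summable_binom_mult[of "\<lambda>_. 1" 1 s]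
  by (simp add: suminf_eq_infsum[symmetric] binom_def sums_iff)

lemma q_powr_eq_1: "complex_of_real q powr w = 1 \<longleftrightarrow> (\<exists>l::int. w = \<delta> * of_int l)"
proof -
  have "complex_of_real q powr w = exp (w * of_real (ln q))"
    using q by (simp add: powr_def Ln_of_real)
  also have "\<dots> = 1 \<longleftrightarrow> (\<exists>l::int. w * of_real (ln q) = of_int (2 * l) * of_real pi * \<i>)"
    unfolding exp_eq_1 by (simp add: complex_eq_iff)
  also have "\<dots> \<longleftrightarrow> (\<exists>l::int. w = \<delta> * of_int l)"
    using ln_q by (simp add: \<delta>_def field_simps)
  finally show ?thesis .
qed

lemma q_powr_add_ne_1: "s \<notin> poles \<Longrightarrow> complex_of_real q powr (s + of_nat n) \<noteq> 1"
proof
  assume "s \<notin> poles" "complex_of_real q powr (s + of_nat n) = 1"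
  then obtain l :: int where "s + of_nat n = \<delta> * of_int l"
    unfolding q_powr_eq_1 by blast
  then have "s = - of_nat n + \<delta> * of_int l"
    by (simp flip: \<open>s + of_nat n = \<delta> * of_int l\<close>)
  with \<open>s \<notin> poles\<close> show False
    unfolding poles_def by blast
qed

section \<open>Analyticity and meromorphy of \<open>Z\<close>\<close>

lemma norm_one_minus_q_powr_ge:
  assumes "1 \<le> Re w"
  shows "1 - q \<le> norm (1 - complex_of_real q powr w)"
proof -
  have "q powr Re w \<le> q powr 1"
    using assms q by (intro powr_mono') auto
  then show ?thesis
    using norm_triangle_ineq2[of 1 "complex_of_real q powr w"] q by (simp add: norm_q_powr)
qed

lemma norm_Z_term_le:
  assumes "norm s \<le> R" "1 \<le> Re s + of_nat n"
  shows "norm (binom s n / (1 - complex_of_real q powr (s + of_nat n))) \<le> binom_bound R n * (1 / (1 - q))"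
proof -
  have R: "R \<ge> 0" using assms(1) norm_ge_zero order_trans by blast
  have "norm (1 / (1 - complex_of_real q powr (s + of_nat n))) \<le> 1 / (1 - q)"
    using norm_one_minus_q_powr_ge[of "s + of_nat n"] assms q
    by (simp add: norm_divide frac_le)
  then have "norm (binom s n) * norm (1 / (1 - complex_of_real q powr (s + of_nat n))) \<le> binom_bound R n * (1 / (1 - q))"
    by (intro mult_mono norm_binom_le assms binom_bound_nonneg R) auto
  then show ?thesis
    by (simp add: norm_divide)
qed

text \<open>For \<open>norm s < N\<close> and \<open>n > N\<close> the real part of
  \<open>s + n\<close> is at least 1, so the denominators are at least \<open>1 - q\<close> in norm
  and the tail is holomorphic. Only finitely many terms can be singular in the disc.\<close>

lemma Z_decompose:
  fixes N :: nat
  obtains H where "H holomorphic_on ball 0 (real N)"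
    and "\<And>s. s \<in> ball 0 (real N) \<Longrightarrow>
       Z s = (\<Sum>n\<le>N. binom s n / (1 - complex_of_real q powr (s + of_nat n))) + H s"
proof
  define t where "t = (\<lambda>n s. binom s n / (1 - complex_of_real q powr (s + of_nat n)))"
  define M where "M = (\<lambda>n. binom_bound (real N) n * (1 / (1 - q)))"
  have M: "M summable_on {N<..}"
    unfolding M_def
    by (intro summable_on_cmult_left summable_on_subset_banach[OF summable_binom_bound]) auto
  have bound: "norm (t n w) \<le> M n" if "norm w \<le> real N" "n \<in> {N<..}" for n w
    unfolding t_def M_def
    using that abs_Re_le_cmod[of w] by (intro norm_Z_term_le) auto
  show "(\<lambda>s. \<Sum>\<^sub>\<infinity>n\<in>{N<..}. t n s) holomorphic_on ball 0 (real N)"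
  proof (rule holomorphic_on_infsum)
    fix n assume n: "n \<in> {N<..}"
    have "1 - complex_of_real q powr (w + of_nat n) \<noteq> 0" if "w \<in> ball 0 (real N)" for w
    proof -
      have "1 \<le> Re (w + of_nat n)"
        using abs_Re_le_cmod[of w] that n by auto
      from norm_one_minus_q_powr_ge[OF this] q show ?thesis by auto
    qed
    then show "t n holomorphic_on ball 0 (real N)"
      using q unfolding t_def binom_def
      by (intro holomorphic_intros) (auto simp: complex_nonpos_Reals_iff)
  next
    fix s :: complex assume s: "s \<in> ball 0 (real N)"
    \<comment> \<open>This radius keeps the closed ball inside the closed disc of radius
      \<open>N\<close>, on which the majorant \<open>M\<close> is valid.\<close>
    have "norm w \<le> real N" if "w \<in> cball s (real N - norm s)" for w
      using that norm_triangle_ineq[of s "w - s"] by (simp add: dist_norm norm_minus_commute)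
    then show "\<exists>r>0. \<exists>M. M summable_on {N<..} \<and> (\<forall>n\<in>{N<..}. \<forall>w\<in>cball s r. norm (t n w) \<le> M n)"
      using s M bound by (intro exI[of _ "real N - norm s"] conjI exI[of _ M]) auto
  qed auto
  fix s :: complex assume s: "s \<in> ball 0 (real N)"
  have "(\<lambda>n. t n s) summable_on {N<..}"
    by (rule abs_summable_summable, rule Infinite_Sum.abs_summable_on_comparison_test'[OF M])
       (use s bound in auto)
  then have "(\<Sum>\<^sub>\<infinity>n\<in>{..N} \<union> {N<..}. t n s) = (\<Sum>\<^sub>\<infinity>n\<in>{..N}. t n s) + (\<Sum>\<^sub>\<infinity>n\<in>{N<..}. t n s)"
    by (intro infsum_Un_disjoint) auto
  moreover have "{..N} \<union> {N<..} = UNIV" by auto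
  ultimately show "Z s = (\<Sum>n\<le>N. binom s n / (1 - complex_of_real q powr (s + of_nat n))) +
                         (\<Sum>\<^sub>\<infinity>n\<in>{N<..}. t n s)"
    by (simp add: Z_def t_def)
qed

lemma Z_analytic_at:
  assumes s: "s \<notin> poles"
  shows "Z analytic_on {s}"
proof -
  obtain N :: nat where N: "norm s < real N"
    using reals_Archimedean2 by blast
  obtain H where H: "H holomorphic_on ball 0 (real N)"
    "\<And>s. s \<in> ball 0 (real N) \<Longrightarrow>
       Z s = (\<Sum>n\<le>N. binom s n / (1 - complex_of_real q powr (s + of_nat n))) + H s"
    using Z_decompose by metis
  have "(\<lambda>s. (\<Sum>n\<le>N. binom s n / (1 - complex_of_real q powr (s + of_nat n))) + H s)
          holomorphic_on ball 0 (real N) - poles"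
    unfolding binom_def
    using q q_powr_add_ne_1
    by (intro holomorphic_intros holomorphic_on_subset[OF H(1)]) (auto simp: complex_nonpos_Reals_iff)
  also have "?this \<longleftrightarrow> Z holomorphic_on ball 0 (real N) - poles"
    using H(2) by (intro holomorphic_cong) auto
  finally have "Z holomorphic_on ball 0 (real N) - poles" .
  moreover have "open (ball 0 (real N) - poles)"
    by (intro open_Diff closed_poles_subset) auto
  ultimately show ?thesis
    using s N by (auto simp: analytic_at)
qed

text \<open>Near each point \<open>Z\<close> is a finite sum of quotients of entire functions plus a
  holomorphic tail.\<close>

lemma Z_meromorphic: "Z meromorphic_on A"
proof -
  have "Z meromorphic_on {s}" for s
  proof -
    obtain N :: nat where N: "norm s < real N"
      using reals_Archimedean2 by blast
    obtain H where H: "H holomorphic_on ball 0 (real N)"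
      "\<And>s. s \<in> ball 0 (real N) \<Longrightarrow>
         Z s = (\<Sum>n\<le>N. binom s n / (1 - complex_of_real q powr (s + of_nat n))) + H s"
      using Z_decompose by metis
    have "(\<lambda>s. binom s n) meromorphic_on {s}" for n
      unfolding binom_def
      by (intro analytic_on_imp_meromorphic_on holomorphic_on_imp_analytic_at[of _ UNIV] holomorphic_intros) auto
    moreover have "(\<lambda>s. complex_of_real q powr (s + of_nat n)) meromorphic_on {s}" for n
      using q by (intro analytic_on_imp_meromorphic_on holomorphic_on_imp_analytic_at[of _ UNIV] holomorphic_intros)
         (auto simp: complex_nonpos_Reals_iff)
    moreover have "H meromorphic_on {s}"
      using N H(1) by (intro analytic_on_imp_meromorphic_on holomorphic_on_imp_analytic_at[of _ "ball 0 (real N)"]) auto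
    ultimately have "(\<lambda>s. (\<Sum>n\<le>N. binom s n / (1 - complex_of_real q powr (s + of_nat n))) + H s) meromorphic_on {s}"
      by (intro meromorphic_intros)
    also have "?this \<longleftrightarrow> Z meromorphic_on {s}"
    proof (rule meromorphic_on_cong)
      have "\<forall>\<^sub>F w in at s. w \<in> ball 0 (real N)"
        using N by (intro eventually_at_in_open') auto
      then show "\<forall>\<^sub>F w in at s'. (\<Sum>n\<le>N. binom w n / (1 - complex_of_real q powr (w + of_nat n))) + H w = Z w"
        if "s' \<in> {s}" for s'
        using that H(2) by (auto elim: eventually_mono)
    qed auto
    finally show ?thesis .
  qed
  then show ?thesis
    using meromorphic_on_meromorphic_at by blast
qed

section \<open>The defining series in the half-plane Re s > 0\<close>

lemma norm_q_power_x: "norm (of_real q ^ k * x) < 1"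
proof -
  have "q ^ k * norm x \<le> 1 * norm x"
    using q by (intro mult_right_mono power_le_one) auto
  then show ?thesis
    using norm_x q by (simp add: norm_mult norm_power)
qed

lemma c_powr: "c powr s = complex_of_real q powr s * complex_of_real (1 - q) powr s"
proof -
  have "c = complex_of_real q * complex_of_real (1 - q)"
    by (simp add: c_def algebra_simps power2_eq_square)
  then show ?thesis
    using q by (simp add: powr_times_real)
qed

text \<open>The factor \<open>1 - q\<close> is a positive real, so extracting it respects the
  principal branch.\<close>

lemma qnum_add_nat:
  "qnum q (of_nat k + z) powr s = (1 - of_real q ^ k * x) powr s / complex_of_real (1 - q) powr s"
proof -
  have "complex_of_real q powr (of_nat k + z) = of_real q ^ k * x"
    using q by (simp add: x_def powr_add powr_nat')
  then have "1 - of_real q ^ k * x = complex_of_real (1 - q) * qnum q (of_nat k + z)"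
    using q by (simp add: qnum_def)
  then have "(1 - of_real q ^ k * x) powr s = complex_of_real (1 - q) powr s * qnum q (of_nat k + z) powr s"
    using q by (simp only:) (rule powr_times_real_left, auto)
  then show ?thesis
    using q by simp
qed

text \<open>Both sides are iterated sums of one double family \<open>t\<close>: summing over
  \<open>n\<close> first is the binomial theorem and gives the defining series, summing over
  \<open>k\<close> first is the geometric series and gives \<open>Z\<close>. Since |q^s| < 1, a
  geometric times a binomial majorant justifies the exchange.\<close>

lemma qzeta_series_eq:
  assumes s: "0 < Re s"
  shows "qzeta_series q z s = c powr s * Z s"
proof -
  define Q where "Q = complex_of_real q powr s"
  define t where "t = (\<lambda>k n. binom s n * of_real q ^ (k * n) * Q ^ k)"
  have normQ: "norm Q < 1"
    using q s by (simp add: Q_def norm_q_powr powr01_less_one)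
  have "(\<lambda>(k, n). norm Q ^ k * binom_bound (norm s) n) summable_on UNIV \<times> UNIV"
  proof (rule summable_on_product_nonneg)
    show "(\<lambda>k. norm Q ^ k) summable_on UNIV"
      using normQ by (intro norm_summable_imp_summable_on) (auto intro: summable_geometric)
  qed (auto intro: summable_binom_bound binom_bound_nonneg)
  then have "(\<lambda>p. norm (case p of (k, n) \<Rightarrow> t k n)) summable_on UNIV \<times> UNIV"
  proof (rule Infinite_Sum.abs_summable_on_comparison_test')
    fix p :: "nat \<times> nat"
    obtain k n where p: "p = (k, n)" by force
    have "norm (t k n) = norm (binom s n) * q ^ (k * n) * norm Q ^ k"
      using q by (simp add: t_def norm_mult norm_power)
    also have "\<dots> \<le> binom_bound (norm s) n * 1 * norm Q ^ k"
      using q by (intro mult_mono norm_binom_le power_le_one) (auto intro: binom_bound_nonneg)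
    finally show "norm (case p of (k, n) \<Rightarrow> t k n) \<le> (case p of (k, n) \<Rightarrow> norm Q ^ k * binom_bound (norm s) n)"
      by (simp add: p mult.commute)
  qed
  then have summ: "(\<lambda>(k, n). t k n) summable_on UNIV \<times> UNIV"
    by (rule abs_summable_summable)
  have inner_k: "(\<Sum>\<^sub>\<infinity>n. t k n) = Q ^ k * (1 - of_real q ^ k * x) powr (- s)" for k
  proof -
    have "t k summable_on UNIV"
      using summable_on_SigmaD1[OF summ, of k] by simp
    then have "(\<Sum>\<^sub>\<infinity>n. t k n) = (\<Sum>n. t k n)"
      by (rule suminf_eq_infsum[symmetric])
    also have "t k n = Q ^ k * (pochhammer s n / fact n * (of_real q ^ k * x) ^ n)" for n
      by (simp add: t_def binom_def power_mult power_mult_distrib mult_ac)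
    then have "(\<Sum>n. t k n) = (\<Sum>n. Q ^ k * (pochhammer s n / fact n * (of_real q ^ k * x) ^ n))"
      by simp
    also have "\<dots> = Q ^ k * (1 - of_real q ^ k * x) powr (- s)"
      by (intro sums_unique[symmetric] sums_mult pochhammer_binomial_sums norm_q_power_x)
    finally show ?thesis .
  qed
  have inner_n: "(\<Sum>\<^sub>\<infinity>k. t k n) = binom s n / (1 - complex_of_real q powr (s + of_nat n))" for n
  proof -
    have qn: "complex_of_real q powr (s + of_nat n) = of_real q ^ n * Q"
      using q by (simp add: Q_def powr_add powr_nat' mult.commute)
    have "q ^ n * norm Q \<le> 1 * norm Q"
      using q by (intro mult_right_mono power_le_one) auto
    then have "norm (of_real q ^ n * Q) < 1"
      using normQ q by (simp add: norm_mult norm_power)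
    then have "((\<lambda>k. (of_real q ^ n * Q) ^ k) has_sum (1 / (1 - of_real q ^ n * Q))) UNIV"
      by (intro norm_summable_imp_has_sum geometric_sums)
         (auto simp: norm_power intro: summable_geometric)
    then have "((\<lambda>k. binom s n * (of_real q ^ n * Q) ^ k) has_sum (binom s n * (1 / (1 - of_real q ^ n * Q)))) UNIV"
      by (rule has_sum_cmult_right)
    also have "(\<lambda>k. binom s n * (of_real q ^ n * Q) ^ k) = (\<lambda>k. t k n)"
      by (simp add: t_def power_mult_distrib mult_ac flip: power_mult)
    finally show ?thesis
      unfolding qn by (simp add: infsumI)
  qed
  have "(\<lambda>k. \<Sum>\<^sub>\<infinity>n. t k n) summable_on UNIV"
    using summable_on_Sigma_banach[OF summ] .
  then have "(\<lambda>k. Q ^ k * (1 - of_real q ^ k * x) powr (- s)) summable_on UNIV"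
    unfolding inner_k .
  then have sum_k: "(\<lambda>k. c powr s * (Q ^ k * (1 - of_real q ^ k * x) powr (- s))) summable_on UNIV"
    by (rule summable_on_cmult_right)
  have "complex_of_real q powr (s * of_nat (k + 1)) / (qnum q (of_nat k + z)) powr s
      = c powr s * (Q ^ k * (1 - of_real q ^ k * x) powr (- s))" for k
  proof -
    \<comment> \<open>One of the k + 1 factors \<open>Q\<close> is absorbed into
      \<open>c powr s\<close>, which is \<open>Q\<close> times the power of \<open>1 - q\<close>;
      this leaves \<open>Q ^ k\<close>.\<close>
    have "complex_of_real q powr (s * of_nat (k + 1)) = Q ^ (k + 1)"
      using q exp_of_nat_mult[of "k + 1" "s * Ln (complex_of_real q)"]
      by (simp add: Q_def powr_def mult_ac)
    then show ?thesis
      unfolding qnum_add_nat c_powr powr_minus Q_def[symmetric]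
      by (simp add: divide_inverse mult_ac)
  qed
  then have "qzeta_series q z s = (\<Sum>k. c powr s * (Q ^ k * (1 - of_real q ^ k * x) powr (- s)))"
    by (simp add: qzeta_series_def)
  also have "\<dots> = c powr s * (\<Sum>\<^sub>\<infinity>k. Q ^ k * (1 - of_real q ^ k * x) powr (- s))"
    by (simp add: suminf_eq_infsum[OF sum_k] infsum_cmult_right')
  also have "(\<Sum>\<^sub>\<infinity>k. Q ^ k * (1 - of_real q ^ k * x) powr (- s)) = (\<Sum>\<^sub>\<infinity>k. \<Sum>\<^sub>\<infinity>n. t k n)"
    by (simp add: inner_k)
  also have "\<dots> = (\<Sum>\<^sub>\<infinity>n. \<Sum>\<^sub>\<infinity>k. t k n)"
    by (rule infsum_swap_banach[OF summ])
  also have "\<dots> = Z s"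
    by (simp add: inner_n Z_def)
  finally show ?thesis .
qed

section \<open>Identification of \<open>qzeta\<close> with the meromorphic continuation\<close>

lemma c_nonpos: "c \<notin> \<real>\<^sub>\<le>\<^sub>0"
proof -
  have "q * q < 1 * q" using q by (intro mult_strict_right_mono) auto
  then show ?thesis
    by (simp add: c_def complex_nonpos_Reals_iff power2_eq_square)
qed

text \<open>No branch correction occurs: \<open>c\<close> is a nonnegative real, and
  \<open>1 - x\<close> lies in the right half-plane because |x| < 1, so \<open>Ln\<close> of its
  inverse is the negated \<open>Ln\<close>.\<close>

lemma divide_one_minus_x_powr: "(c / (1 - x)) powr s = c powr s * (1 - x) powr (- s)"
proof -
  have "0 < Re (1 - x)"
    using norm_x abs_Re_le_cmod[of x] by simp
  then have nonpos: "1 - x \<notin> \<real>\<^sub>\<le>\<^sub>0" and nz: "1 - x \<noteq> 0"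
    by (auto simp: complex_nonpos_Reals_iff)
  have "c \<in> \<real>" "0 \<le> Re c"
    using c_nonpos by (auto simp: c_def complex_nonpos_Reals_iff)
  then have "(c * inverse (1 - x)) powr s = c powr s * inverse (1 - x) powr s"
    by (rule powr_times_real_left)
  also have "inverse (1 - x) powr s = (1 - x) powr (- s)"
    using nz Ln_inverse[OF nonpos] by (simp add: powr_def)
  finally show ?thesis
    by (simp add: divide_inverse)
qed

lemma Re_poles: "p \<in> poles \<Longrightarrow> Re p \<le> 0"
  by (auto simp: poles_def \<delta>_def Re_divide_of_real)

text \<open>\<open>remove_sings\<close> of the product satisfies the normalised definition, since no
  pole lies in the half-plane of convergence; the identity theorem gives the uniqueness behind
  \<open>THE\<close>. Off \<open>poles\<close> the product is analytic, so its values are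
  unchanged.\<close>

lemma qzeta_eq:
  assumes "s \<notin> poles"
  shows "qzeta q z s = c powr s * Z s"
proof -
  define G where "G = (\<lambda>s. c powr s * Z s)"
  have "(\<lambda>s. c powr s) holomorphic_on UNIV"
    using c_nonpos by (intro holomorphic_intros) auto
  then have "(\<lambda>s. c powr s) analytic_on UNIV"
    by (simp add: analytic_on_open)
  then have c_an: "(\<lambda>s. c powr s) analytic_on A" for A
    using analytic_on_subset by blast
  have G_an: "G analytic_on {s}" if "s \<notin> poles" for s
    unfolding G_def using that by (intro analytic_on_mult c_an Z_analytic_at)
  have "G meromorphic_on UNIV"
    unfolding G_def by (intro meromorphic_on_mult Z_meromorphic analytic_on_imp_meromorphic_on c_an)
  then have nice: "remove_sings G nicely_meromorphic_on UNIV"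
    by (rule remove_sings_nicely_meromorphic)
  have series: "remove_sings G s = qzeta_series q z s" if "0 < Re s" for s
  proof -
    have "s \<notin> poles" using that Re_poles[of s] by auto
    then have "remove_sings G s = G s" by (intro remove_sings_at_analytic G_an)
    then show ?thesis using qzeta_series_eq[OF that] by (simp add: G_def)
  qed
  have "qzeta q z = remove_sings G"
    unfolding qzeta_def
  proof (rule the_equality)
    show "remove_sings G nicely_meromorphic_on UNIV \<and>
          (\<forall>s. 0 < Re s \<longrightarrow> remove_sings G s = qzeta_series q z s)"
      using nice series by blast
  next
    fix f assume f: "f nicely_meromorphic_on UNIV \<and> (\<forall>s. 0 < Re s \<longrightarrow> f s = qzeta_series q z s)"
    \<comment> \<open>The point 1 lies in the half-plane, so both candidates equal the series near
      it; this starts the identity theorem.\<close>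
    have "\<forall>\<^sub>F s in at 1. s \<in> {s. 0 < Re s}"
      by (intro eventually_at_in_open' open_halfspace_Re_gt) auto
    then have ev: "\<forall>\<^sub>F s in at 1. f s = remove_sings G s"
      by eventually_elim (use f series in auto)
    show "f = remove_sings G"
    proof
      fix s
      show "f s = remove_sings G s"
        by (rule nicely_meromorphic_on_eqI[OF _ nice _ _ _ ev]) (use f in auto)
    qed
  qed
  then show ?thesis
    using remove_sings_at_analytic[OF G_an[OF assms]] by (simp add: G_def)
qed

section \<open>The double series over l and n\<close>

definition series_poles :: "complex set" where
  "series_poles = {s. \<exists>(r::nat) (l::int). l \<noteq> 0 \<and> s = - of_nat r + \<delta> * of_int l}"

text \<open>Summed over \<open>n\<close> this gives the summand of the theorem with index
  \<open>l\<close>, see \<open>hyp2F1_eq_series\<close>.\<close>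

definition series_term :: "complex \<Rightarrow> int \<Rightarrow> nat \<Rightarrow> complex" where
  "series_term s l n = binom (s + 1) n / (of_int l * (s + of_nat n + \<delta> * of_int l))"

lemma series_poles_subset: "series_poles \<subseteq> poles"
  unfolding series_poles_def poles_def by blast

lemma series_polesI: "l \<noteq> 0 \<Longrightarrow> s + of_nat n + \<delta> * of_int l = 0 \<Longrightarrow> s \<in> series_poles"
proof -
  assume l: "l \<noteq> 0" and 0: "s + of_nat n + \<delta> * of_int l = 0"
  have "s = (s + of_nat n + \<delta> * of_int l) - of_nat n - \<delta> * of_int l"
    by simp
  also have "\<dots> = - of_nat n + \<delta> * of_int (- l)"
    unfolding 0 by simp
  finally show "s \<in> series_poles"
    unfolding series_poles_def using l by (intro CollectI exI[of _ n] exI[of _ "- l"]) simp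
qed

text \<open>The pole -n - \<delta> l has imaginary part of size |Im \<delta>| |l|, so its distance
  from \<open>w\<close> is at least a constant times |l|, uniformly in \<open>n\<close>. With the
  explicit factor 1/l the majorant is a product of 1/l^2 and a binomial term.\<close>

lemma series_term_bound:
  assumes s: "s \<notin> series_poles"
  shows "\<exists>r>0. \<exists>M. M summable_on {l. l \<noteq> 0} \<times> UNIV \<and>
    (\<forall>p\<in>{l. l \<noteq> 0} \<times> UNIV. \<forall>w\<in>cball s r. norm (case p of (l, n) \<Rightarrow> series_term w l n) \<le> M p)"
proof -
  obtain r k where r: "r > 0" and k: "k > 0"
    and bound: "\<And>w a. w \<in> cball s r \<Longrightarrow> a \<in> series_poles \<Longrightarrow> k * norm a \<le> norm (w - a)"
    using norm_diff_ge_closed[OF closed_poles_subset[OF series_poles_subset] s] by blast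
  define k' where "k' = k * \<bar>Im \<delta>\<bar>"
  have k': "k' > 0" using k Im_delta by (simp add: k'_def)
  \<comment> \<open>The added 1 is there because the binomial factor is taken at
    \<open>w + 1\<close>.\<close>
  define R where "R = norm s + r + 1"
  have R: "R \<ge> 0" using r by (simp add: R_def add_nonneg_nonneg)
  define M where "M = (\<lambda>(l::int, n). 1 / k' * (1 / (of_int l)\<^sup>2) * binom_bound R n)"
  have "M summable_on {l. l \<noteq> 0} \<times> UNIV"
    unfolding M_def using k'
    by (intro summable_on_product_nonneg summable_on_cmult_right summable_on_inverse_squares_int
          summable_binom_bound binom_bound_nonneg R) auto
  moreover have "norm (series_term w l n) \<le> M (l, n)" if l: "l \<noteq> 0" and w: "w \<in> cball s r" for l n w
  proof -
    \<comment> \<open>The zero in \<open>w\<close> of the denominator; its lattice index is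
      \<open>- l\<close>.\<close>
    define a where "a = - of_nat n + \<delta> * of_int (- l)"
    have "a \<in> series_poles"
      unfolding a_def series_poles_def using l by (intro CollectI exI[of _ n] exI[of _ "- l"]) simp
    then have "k * norm a \<le> norm (w - a)"
      by (rule bound[OF w])
    moreover have "\<bar>Im \<delta>\<bar> * \<bar>of_int l\<bar> \<le> norm a"
      using abs_Im_le_cmod[of a] by (simp add: a_def abs_mult)
    then have "k * (\<bar>Im \<delta>\<bar> * \<bar>of_int l\<bar>) \<le> k * norm a"
      using k by (intro mult_left_mono) auto
    moreover have "w - a = w + of_nat n + \<delta> * of_int l"
      by (simp add: a_def)
    ultimately have ge: "k' * \<bar>of_int l\<bar> \<le> norm (w + of_nat n + \<delta> * of_int l)"
      by (simp add: k'_def mult.assoc)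
    have pos: "0 < k' * \<bar>real_of_int l\<bar>" using l k' by simp
    have "1 / norm (w + of_nat n + \<delta> * of_int l) \<le> 1 / (k' * \<bar>of_int l\<bar>)"
      using ge by (rule divide_left_mono) (use pos ge in \<open>auto intro!: mult_pos_pos\<close>)
    moreover have "norm (w + 1) \<le> R"
      using w norm_triangle_ineq[of s "w - s"] norm_triangle_ineq[of w 1]
      by (simp add: R_def dist_norm norm_minus_commute)
    ultimately have "norm (binom (w + 1) n) * (1 / \<bar>of_int l\<bar> * (1 / norm (w + of_nat n + \<delta> * of_int l)))
        \<le> binom_bound R n * (1 / \<bar>of_int l\<bar> * (1 / (k' * \<bar>of_int l\<bar>)))"
      by (intro mult_mono norm_binom_le binom_bound_nonneg R mult_left_mono) auto
    then show ?thesis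
      by (simp add: series_term_def M_def norm_mult norm_divide power2_eq_square mult_ac)
  qed
  ultimately show ?thesis
    using r by (intro exI[of _ r] conjI exI[of _ M]) auto
qed

lemma series_term_abs_summable:
  assumes "s \<notin> series_poles"
  shows "(\<lambda>(l, n). norm (series_term s l n)) summable_on {l. l \<noteq> 0} \<times> UNIV"
proof -
  obtain r M where "r > 0" "M summable_on {l. l \<noteq> 0} \<times> (UNIV :: nat set)"
    "\<forall>p\<in>{l. l \<noteq> 0} \<times> UNIV. \<forall>w\<in>cball s r. norm (case p of (l, n) \<Rightarrow> series_term w l n) \<le> M p"
    using series_term_bound[OF assms] by blast
  then have "(\<lambda>p. norm (case p of (l, n) \<Rightarrow> series_term s l n)) summable_on {l. l \<noteq> 0} \<times> UNIV"
    by (intro Infinite_Sum.abs_summable_on_comparison_test'[where g = M]) auto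
  then show ?thesis
    by (simp add: case_prod_unfold)
qed

lemma series_term_summable:
  assumes "s \<notin> series_poles"
  shows "(\<lambda>(l, n). series_term s l n) summable_on {l. l \<noteq> 0} \<times> UNIV"
proof (rule abs_summable_summable)
  show "(\<lambda>p. norm (case p of (l, n) \<Rightarrow> series_term s l n)) summable_on {l. l \<noteq> 0} \<times> UNIV"
    using series_term_abs_summable[OF assms] by (simp add: case_prod_unfold)
qed

text \<open>Common form of all hypergeometric values in the theorem: a = b = s in the first term, a
  = s + \<delta> l and b = s + 1 inside the series.\<close>

lemma hyp2F1_eq_infsum:
  assumes nz: "\<And>n. a + of_nat n \<noteq> 0" and summ: "(\<lambda>n. binom b n / (a + of_nat n)) summable_on UNIV"
  shows "hyp2F1 b a (a + 1) x = a * (\<Sum>\<^sub>\<infinity>n. binom b n / (a + of_nat n))"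
proof -
  have "(\<lambda>n. a * (binom b n / (a + of_nat n))) summable_on UNIV"
    using summ by (rule summable_on_cmult_right)
  from suminf_eq_infsum[OF this] have "(\<Sum>n. a * (binom b n / (a + of_nat n))) = a * (\<Sum>\<^sub>\<infinity>n. binom b n / (a + of_nat n))"
    unfolding infsum_cmult_right' .
  then show ?thesis
    by (simp add: hyp2F1_succ[OF nz] binom_def mult_ac)
qed

text \<open>The prefactor cancels the factor \<open>a\<close> that \<open>hyp2F1_eq_infsum\<close>
  puts in front of the sum.\<close>

lemma hyp2F1_eq_series:
  assumes s: "s \<notin> series_poles" and l: "l \<noteq> 0"
  shows "1 / (of_int l * (s + \<delta> * of_int l)) * hyp2F1 (s + 1) (s + \<delta> * of_int l) (s + 1 + \<delta> * of_int l) x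
       = (\<Sum>\<^sub>\<infinity>n. series_term s l n)"
proof -
  define a where "a = s + \<delta> * of_int l"
  have nz: "a + of_nat n \<noteq> 0" for n
    using series_polesI[OF l, of s n] s by (auto simp: a_def algebra_simps)
  have eq: "binom (s + 1) n / (a + of_nat n) = of_int l * series_term s l n" for n
    using l by (simp add: series_term_def a_def add_ac)
  have "series_term s l summable_on UNIV"
    using summable_on_SigmaD1[OF series_term_summable[OF s], of l] l by simp
  then have "(\<lambda>n. binom (s + 1) n / (a + of_nat n)) summable_on UNIV"
    unfolding eq by (rule summable_on_cmult_right)
  from hyp2F1_eq_infsum[OF nz this]
  have "hyp2F1 (s + 1) a (a + 1) x = a * of_int l * (\<Sum>\<^sub>\<infinity>n. series_term s l n)"
    unfolding eq by (simp add: infsum_cmult_right')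
  then have "1 / (of_int l * a) * hyp2F1 (s + 1) a (a + 1) x = (\<Sum>\<^sub>\<infinity>n. series_term s l n)"
    using nz[of 0] l by simp
  then show ?thesis
    by (simp add: a_def add_ac)
qed

lemma abs_summable_hyp2F1_series:
  assumes s: "s \<notin> series_poles"
  shows "(\<lambda>l. norm (\<Sum>\<^sub>\<infinity>n. series_term s l n)) summable_on {l. l \<noteq> 0}"
proof (rule Infinite_Sum.abs_summable_on_comparison_test')
  show "(\<lambda>l. \<Sum>\<^sub>\<infinity>n. norm (series_term s l n)) summable_on {l. l \<noteq> 0}"
    using summable_on_Sigma_banach[OF series_term_abs_summable[OF s]] .
  show "norm (\<Sum>\<^sub>\<infinity>n. series_term s l n) \<le> (\<Sum>\<^sub>\<infinity>n. norm (series_term s l n))" if "l \<in> {l. l \<noteq> 0}" for l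
    using summable_on_SigmaD1[OF series_term_abs_summable[OF s] that] by (rule norm_infsum_bound)
qed

text \<open>Holomorphy is shown for the unordered sum over pairs, to which the joint majorant
  applies; summability then identifies it with the iterated sum.\<close>

lemma holomorphic_hyp2F1_series:
  "(\<lambda>s. \<Sum>\<^sub>\<infinity>l\<in>{l. l \<noteq> 0}. \<Sum>\<^sub>\<infinity>n. series_term s l n) holomorphic_on - series_poles"
proof -
  have "(\<lambda>s. \<Sum>\<^sub>\<infinity>p\<in>{l. l \<noteq> 0} \<times> UNIV. case p of (l, n) \<Rightarrow> series_term s l n) holomorphic_on - series_poles"
  proof (rule holomorphic_on_infsum)
    show "open (- series_poles)"
      using closed_poles_subset[OF series_poles_subset] by (simp add: open_Compl)
    fix p :: "int \<times> nat" assume "p \<in> {l. l \<noteq> 0} \<times> UNIV"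
    then obtain l n where p: "p = (l, n)" and l: "l \<noteq> 0" by blast
    have "of_int l * (s + of_nat n + \<delta> * of_int l) \<noteq> 0" if "s \<in> - series_poles" for s
      using series_polesI[OF l, of s n] that l by auto
    then show "(\<lambda>s. case p of (l, n) \<Rightarrow> series_term s l n) holomorphic_on - series_poles"
      unfolding p prod.case series_term_def binom_def
      by (intro holomorphic_intros) auto
  qed (use series_term_bound in auto)
  also have "?this \<longleftrightarrow> ?thesis"
    by (intro holomorphic_cong refl infsum_Sigma'_banach[symmetric] series_term_summable) auto
  finally show ?thesis .
qed

text \<open>For w = \<delta> u one has q^w = exp(2 pi i u) and 1/(1 - q^w) = 1/2 - cot(pi u)/(2i),
  so the cotangent expansion applies.\<close>

lemma one_minus_q_powr_partial_fractions:
  assumes w: "complex_of_real q powr w \<noteq> 1"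
  shows "1 / (1 - complex_of_real q powr w) = 1 / 2 - 1 / (w * of_real (ln q)) +
     w / (2 * of_real pi * \<i>) * (\<Sum>\<^sub>\<infinity>l\<in>{l::int. l \<noteq> 0}. 1 / (of_int l * (w + \<delta> * of_int l)))"
proof -
  define u where "u = w / \<delta>"
  have w_eq: "w = \<delta> * u" using delta_nz by (simp add: u_def)
  have u: "u \<notin> \<int>"
    using w unfolding q_powr_eq_1 w_eq by (auto elim: Ints_cases)
  then have w0: "w \<noteq> 0" and u0: "u \<noteq> 0" using delta_nz by (auto simp: w_eq)
  define L where "L = complex_of_real (ln q)"
  have L: "L \<noteq> 0" using ln_q by (simp add: L_def)
  \<comment> \<open>The half-angle exponential: its square is q^w, while \<open>cos\<close> and
    \<open>sin\<close> of pi u are expressed through \<open>e\<close> and its inverse.\<close>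
  define e where "e = exp (\<i> * (of_real pi * u))"
  have e0: "e \<noteq> 0" by (simp add: e_def)
  have "complex_of_real q powr w = exp (w * L)"
    using q by (simp add: powr_def Ln_of_real L_def)
  also have "w * L = \<i> * (of_real pi * u) + \<i> * (of_real pi * u)"
    using L by (simp add: w_eq \<delta>_def flip: L_def)
  finally have qe: "complex_of_real q powr w = e\<^sup>2"
    by (simp only: e_def exp_add power2_eq_square)
  then have e1: "e\<^sup>2 \<noteq> 1" using w by simp
  have "cos (of_real pi * u) = (e + 1 / e) / 2" "sin (of_real pi * u) = (e - 1 / e) / (2 * \<i>)"
    by (simp_all add: cos_exp_eq sin_exp_eq e_def exp_minus inverse_eq_divide)
  moreover have "e - 1 / e \<noteq> 0"
    using e0 e1 by (simp add: field_simps power2_eq_square)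
  moreover have "a / 2 / (b / (2 * \<i>)) = \<i> * a / b" for a b :: complex
    unfolding divide_divide_eq_right by simp
  ultimately have "cot (of_real pi * u) = \<i> * (e + 1 / e) / (e - 1 / e)"
    by (simp only: cot_def)
  also have "\<dots> = \<i> * (e\<^sup>2 + 1) / (e\<^sup>2 - 1)"
  proof -
    have "e + 1 / e = (e\<^sup>2 + 1) / e" "e - 1 / e = (e\<^sup>2 - 1) / e"
      using e0 by (simp_all add: field_simps power2_eq_square)
    then show ?thesis
      using e0 by (simp only: times_divide_eq_right) simp
  qed
  finally have cot: "cot (of_real pi * u) = \<i> * (e\<^sup>2 + 1) / (e\<^sup>2 - 1)" .
  have "((\<lambda>l::int. 1 / \<delta> * (1 / (of_int l * (u + of_int l)))) has_sum
          1 / \<delta> * ((1 / u - of_real pi * cot (of_real pi * u)) / u)) {l. l \<noteq> 0}"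
    by (intro has_sum_cmult_right cot_partial_fractions u)
  also have "(\<lambda>l::int. 1 / \<delta> * (1 / (of_int l * (u + of_int l)))) = (\<lambda>l. 1 / (of_int l * (w + \<delta> * of_int l)))"
    by (simp add: w_eq algebra_simps)
  finally have "w / (2 * of_real pi * \<i>) * (\<Sum>\<^sub>\<infinity>l\<in>{l::int. l \<noteq> 0}. 1 / (of_int l * (w + \<delta> * of_int l)))
      = w / (2 * of_real pi * \<i>) * (1 / \<delta> * ((1 / u - of_real pi * cot (of_real pi * u)) / u))"
    by (simp add: infsumI)
  also have "\<dots> = 1 / (2 * of_real pi * \<i> * u) - cot (of_real pi * u) / (2 * \<i>)"
  proof -
    have *: "\<delta> * u / a * (1 / \<delta> * (b / u)) = b / a" for a b
      using u0 delta_nz by simp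
    show ?thesis
      unfolding w_eq * by (simp add: diff_divide_distrib)
  qed
  \<comment> \<open>Since \<delta> log q = 2 pi i, the term 1/u of the cotangent expansion becomes
    the term in 1/(w log q).\<close>
  also have "2 * of_real pi * \<i> * u = w * L"
    using L by (simp add: w_eq \<delta>_def flip: L_def)
  finally have "w / (2 * of_real pi * \<i>) * (\<Sum>\<^sub>\<infinity>l\<in>{l::int. l \<noteq> 0}. 1 / (of_int l * (w + \<delta> * of_int l)))
      = 1 / (w * L) - cot (of_real pi * u) / (2 * \<i>)" .
  moreover have "1 / (1 - e\<^sup>2) = 1 / 2 - cot (of_real pi * u) / (2 * \<i>)"
  proof -
    define d where "d = e\<^sup>2 - 1"
    have d: "d \<noteq> 0" "e\<^sup>2 = d + 1"
      using e1 by (simp_all add: d_def)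
    have cot': "cot (of_real pi * u) / (2 * \<i>) = (d + 2) / d / 2"
      unfolding cot d(2) using d(1) by (simp add: field_simps)
    show ?thesis
      unfolding cot' d(2) using d(1) by (simp add: field_simps)
  qed
  ultimately show ?thesis
    by (simp add: qe L_def)
qed

text \<open>Partial fractions at w = s + n split each term of \<open>Z\<close> into three families,
  each summable over \<open>n\<close> by itself. Off \<open>poles\<close> every such expansion is
  available.\<close>

lemma Z_eq_hyp2F1_series:
  assumes s: "s \<notin> poles"
  shows "Z s = - 1 / (s * of_real (ln q)) * hyp2F1 s s (s + 1) x + 1 / 2 * (1 - x) powr (- s) +
           s / (2 * of_real pi * \<i>) * (\<Sum>\<^sub>\<infinity>l\<in>{l. l \<noteq> 0}. \<Sum>\<^sub>\<infinity>n. series_term s l n)"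
proof -
  have s': "s \<notin> series_poles" using s series_poles_subset by blast
  have pole: "- of_nat n \<in> poles" for n
    unfolding poles_def by (rule CollectI, rule exI[of _ n], rule exI[of _ 0]) simp
  have nz: "s + of_nat n \<noteq> 0" for n
    using s pole[of n] by (auto simp: add_eq_0_iff2)
  \<comment> \<open>The radius of a pole-free ball bounds all |s + n| from below, since each -n is a
    pole (l = 0).\<close>
  obtain e where e: "e > 0" "ball s e \<subseteq> - poles"
    using s closed_poles_subset[OF order_refl] open_contains_ball[of "- poles"] by auto
  have "norm (1 / (s + of_nat n)) \<le> 1 / e" for n
  proof -
    have "- of_nat n \<notin> ball s e" using e pole by blast
    then have "e \<le> norm (s + of_nat n)" by (simp add: dist_norm)
    then show ?thesis using e by (simp add: norm_divide frac_le)
  qed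
  then have sum2: "(\<lambda>n. binom s n * (1 / (s + of_nat n))) summable_on UNIV"
    by (rule summable_binom_mult)
  have sum1: "(\<lambda>n. binom s n * (1 / 2)) summable_on UNIV"
    by (rule summable_binom_mult[of _ "1 / 2"]) simp
  define S where "S = (\<lambda>n. \<Sum>\<^sub>\<infinity>l\<in>{l. l \<noteq> 0}. series_term s l n)"
  have "(\<lambda>(n, l). series_term s l n) summable_on UNIV \<times> {l. l \<noteq> 0}"
    using series_term_summable[OF s'] by (subst summable_on_swap) simp
  then have sum3: "S summable_on UNIV"
    unfolding S_def by (rule summable_on_Sigma_banach)
  \<comment> \<open>Absorbs the factor s + n of the partial fractions; this is why the series
    contains \<open>s + 1\<close> as first parameter and \<open>s\<close> in front.\<close>
  have shift: "binom s n * (s + of_nat n) = s * binom (s + 1) n" for n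
    using pochhammer_rec[of s n] pochhammer_Suc[of s n] by (simp add: binom_def)
  have "binom s n / (1 - complex_of_real q powr (s + of_nat n)) =
      binom s n * (1 / 2) + (- 1 / of_real (ln q)) * (binom s n * (1 / (s + of_nat n))) + s / (2 * of_real pi * \<i>) * S n" for n
  proof -
    have "S n = (\<Sum>\<^sub>\<infinity>l\<in>{l::int. l \<noteq> 0}. binom (s + 1) n * (1 / (of_int l * (s + of_nat n + \<delta> * of_int l))))"
      by (simp add: S_def series_term_def)
    also have "\<dots> = binom (s + 1) n * (\<Sum>\<^sub>\<infinity>l\<in>{l::int. l \<noteq> 0}. 1 / (of_int l * (s + of_nat n + \<delta> * of_int l)))"
      by (rule infsum_cmult_right')
    finally have "s * S n = binom s n * (s + of_nat n) *
        (\<Sum>\<^sub>\<infinity>l\<in>{l::int. l \<noteq> 0}. 1 / (of_int l * (s + of_nat n + \<delta> * of_int l)))"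
      by (simp add: shift)
    then have "s / (2 * of_real pi * \<i>) * S n = binom s n * ((s + of_nat n) / (2 * of_real pi * \<i>) *
        (\<Sum>\<^sub>\<infinity>l\<in>{l::int. l \<noteq> 0}. 1 / (of_int l * (s + of_nat n + \<delta> * of_int l))))"
      by simp
    moreover have "binom s n / (1 - complex_of_real q powr (s + of_nat n)) =
       binom s n * (1 / (1 - complex_of_real q powr (s + of_nat n)))" by simp
    ultimately show ?thesis
      unfolding one_minus_q_powr_partial_fractions[OF q_powr_add_ne_1[OF s]]
      by (simp add: algebra_simps)
  qed
  then have "Z s = (\<Sum>\<^sub>\<infinity>n. binom s n * (1 / 2) + (- 1 / of_real (ln q)) * (binom s n * (1 / (s + of_nat n))) + s / (2 * of_real pi * \<i>) * S n)"
    by (simp add: Z_def)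
  also have "\<dots> = (\<Sum>\<^sub>\<infinity>n. binom s n * (1 / 2)) + (- 1 / of_real (ln q)) * (\<Sum>\<^sub>\<infinity>n. binom s n * (1 / (s + of_nat n)))
      + s / (2 * of_real pi * \<i>) * (\<Sum>\<^sub>\<infinity>n. S n)"
    by (simp only: infsum_add infsum_cmult_right' summable_on_add summable_on_cmult_right sum1 sum2 sum3)
  also have "(\<Sum>\<^sub>\<infinity>n. binom s n * (1 / 2)) = 1 / 2 * (1 - x) powr (- s)"
    unfolding infsum_cmult_left' binom_sum by simp
  also have "(\<Sum>\<^sub>\<infinity>n. binom s n * (1 / (s + of_nat n))) = 1 / s * hyp2F1 s s (s + 1) x"
    using hyp2F1_eq_infsum[OF nz, of s] sum2 nz[of 0] by simp
  also have "(\<Sum>\<^sub>\<infinity>n. S n) = (\<Sum>\<^sub>\<infinity>l\<in>{l. l \<noteq> 0}. \<Sum>\<^sub>\<infinity>n. series_term s l n)"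
    unfolding S_def by (rule infsum_swap_banach[OF series_term_summable[OF s'], symmetric])
  finally show ?thesis
    by (simp add: mult.commute)
qed

end

theorem theorem1:
  fixes q :: real and z :: complex
  assumes q: "0 < q" "q < 1" and z: "0 < Re z"
  defines "\<delta> \<equiv> 2 * complex_of_real pi * \<i> / complex_of_real (ln q)"
  defines "c \<equiv> complex_of_real (q - q\<^sup>2)"
  defines "x \<equiv> complex_of_real q powr z"
  defines "T \<equiv> (\<lambda>s (l::int). 1 / (of_int l * (s + \<delta> * of_int l)) *
                  hyp2F1 (s + 1) (s + \<delta> * of_int l) (s + 1 + \<delta> * of_int l) x)"
  defines "E \<equiv> {s. \<exists>(r::nat) (l::int). l \<noteq> 0 \<and> s = - of_nat r + \<delta> * of_int l}"
  shows "(\<forall>s. s \<notin> E \<longrightarrow> (\<lambda>l. norm (T s l)) summable_on {l::int. l \<noteq> 0})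
       \<and> (\<lambda>s. \<Sum>\<^sub>\<infinity>l\<in>{l::int. l \<noteq> 0}. T s l) holomorphic_on (- E)
       \<and> (\<forall>s. (\<forall>(r::nat) (l::int). s \<noteq> - of_nat r + \<delta> * of_int l) \<longrightarrow>
            qzeta q z s =
              - (c powr s) / (s * complex_of_real (ln q)) * hyp2F1 s s (s + 1) x
              + 1/2 * (c / (1 - x)) powr s
              + s * c powr s / (2 * complex_of_real pi * \<i>) *
                  (\<Sum>\<^sub>\<infinity>l\<in>{l::int. l \<noteq> 0}. T s l))"
proof -
  interpret Q: q_zeta q z
    by unfold_locales (fact q z)+
  have \<delta>: "\<delta> = Q.\<delta>" and c: "c = Q.c" and x: "x = Q.x"
    by (simp_all add: \<delta>_def c_def x_def Q.\<delta>_def Q.c_def Q.x_def)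
  have E: "E = Q.series_poles"
    by (simp add: E_def Q.series_poles_def \<delta>)
  \<comment> \<open>Off \<open>E\<close> no denominator in the double series vanishes, so the
    hypergeometric summands can be replaced by sums of \<open>series_term\<close>.\<close>
  have T: "T s l = (\<Sum>\<^sub>\<infinity>n. Q.series_term s l n)" if "s \<notin> E" "l \<noteq> 0" for s l
    using Q.hyp2F1_eq_series[of s l] that by (simp add: T_def E \<delta> x)
  have sum_T: "(\<Sum>\<^sub>\<infinity>l\<in>{l. l \<noteq> 0}. T s l) = (\<Sum>\<^sub>\<infinity>l\<in>{l. l \<noteq> 0}. \<Sum>\<^sub>\<infinity>n. Q.series_term s l n)"
    if "s \<notin> E" for s
    using T[OF that] by (intro infsum_cong) auto
  show ?thesis
  proof (intro conjI allI impI)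
    show "(\<lambda>l. norm (T s l)) summable_on {l. l \<noteq> 0}" if "s \<notin> E" for s
    proof -
      have "(\<lambda>l. norm (T s l)) summable_on {l. l \<noteq> 0} \<longleftrightarrow>
            (\<lambda>l. norm (\<Sum>\<^sub>\<infinity>n. Q.series_term s l n)) summable_on {l. l \<noteq> 0}"
        using T[OF that] by (intro summable_on_cong) auto
      then show ?thesis
        using Q.abs_summable_hyp2F1_series[of s] that by (simp add: E)
    qed
  next
    have "(\<lambda>s. \<Sum>\<^sub>\<infinity>l\<in>{l. l \<noteq> 0}. T s l) holomorphic_on - E \<longleftrightarrow>
          (\<lambda>s. \<Sum>\<^sub>\<infinity>l\<in>{l. l \<noteq> 0}. \<Sum>\<^sub>\<infinity>n. Q.series_term s l n) holomorphic_on - E"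
      using sum_T by (intro holomorphic_cong) auto
    then show "(\<lambda>s. \<Sum>\<^sub>\<infinity>l\<in>{l. l \<noteq> 0}. T s l) holomorphic_on - E"
      using Q.holomorphic_hyp2F1_series by (simp add: E)
  next
    fix s assume "\<forall>(r::nat) (l::int). s \<noteq> - of_nat r + \<delta> * of_int l"
    then have s: "s \<notin> Q.poles"
      unfolding Q.poles_def \<delta> by blast
    then have "s \<notin> E"
      using Q.series_poles_subset E by blast
    show "qzeta q z s =
              - (c powr s) / (s * complex_of_real (ln q)) * hyp2F1 s s (s + 1) x
              + 1/2 * (c / (1 - x)) powr s
              + s * c powr s / (2 * complex_of_real pi * \<i>) *
                  (\<Sum>\<^sub>\<infinity>l\<in>{l::int. l \<noteq> 0}. T s l)"
      \<comment> \<open>Multiplying the three parts of \<open>Z s\<close> by \<open>c powr s\<close>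
        gives the three terms; in the middle one the powers of \<open>c\<close> and
        \<open>1 - x\<close> combine.\<close>
      unfolding Q.qzeta_eq[OF s] Q.Z_eq_hyp2F1_series[OF s] sum_T[OF \<open>s \<notin> E\<close>] c x Q.divide_one_minus_x_powr
      by (simp add: distrib_left right_diff_distrib mult_ac)
  qed
qed

end
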